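(* Let $S=(S_t)_{t\ge0}$ be a subordinator with Laplace exponent $\phi$, and let $H(\lambda)=\phi(\lambda)-\lambda\phi'(\lambda)$. Then there exists a constant $C_S>0$ such that $$\mathbb{P}\big(S_t\ge r(1+et\phi(r^{-1}))\big)\le C_S\,tH(r^{-1})\qquad\text{for all } t,r>0.$$ In particular, if $0<\varepsilon<1$, then $$\mathbb{P}(S_t\ge r)\le C_S\,tH(\varepsilon^{-1}r^{-1})\le C_S\,\varepsilon^{-2}tH(r^{-1})$$ for all $t,r>0$ satisfying $t\phi(r^{-1})\le e^{-1}(1-\varepsilon)$.
   Context: A subordinator $S=(S_t)_{t\ge0}$ is an increasing Lévy process with values in $[0,\infty)$, started at $0$. Its Laplace exponent $\phi$ is defined by $\mathbb{E}e^{-\lambda S_t}=e^{-t\phi(\lambda)}$, $\lambda>0$, and $\phi(\lambda)=b\lambda+\int_{(0,\infty)}(1-e^{-\lambda s})\mu(ds)$, where $b\ge0$ is the drift and $\mu$ is the Lévy measure, a measure on $(0,\infty)$ with $\int_{(0,\infty)}(1\wedge s)\mu(ds)<\infty$. *)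

theory Defs
  imports "HOL-Probability.Probability"
begin

text \<open>
  Processes are indexed by the type \<^typ>\<open>real\<close>, but only times \<open>t \<ge> 0\<close> are meaningful:
  nothing is assumed about \<open>X t\<close> for \<open>t < 0\<close>.  Path properties are required almost surely.
\<close>

locale levy_process = prob_space M for M :: "'a measure" +
  fixes X :: "real \<Rightarrow> 'a \<Rightarrow> real"
  assumes random_variable_at: "\<And>t. t \<ge> 0 \<Longrightarrow> random_variable borel (X t)"
    and starts_at_0: "AE \<omega> in M. X 0 \<omega> = 0"
    and indep_increments:
      "\<And>(\<tau> :: nat \<Rightarrow> real) n. 0 \<le> \<tau> 0 \<Longrightarrow> (\<And>i. i < n \<Longrightarrow> \<tau> i \<le> \<tau> (Suc i)) \<Longrightarrow>
         indep_vars (\<lambda>_. borel) (\<lambda>i \<omega>. X (\<tau> (Suc i)) \<omega> - X (\<tau> i) \<omega>) {..<n}"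
    and stationary_increments:
      "\<And>s h. 0 \<le> s \<Longrightarrow> 0 \<le> h \<Longrightarrow>
         distr M borel (\<lambda>\<omega>. X (s + h) \<omega> - X s \<omega>) = distr M borel (X h)"
    and right_continuous:
      "AE \<omega> in M. \<forall>t\<ge>0. continuous (at_right t) (\<lambda>u. X u \<omega>)"
    and left_limits:
      "AE \<omega> in M. \<forall>t>0. \<exists>l. ((\<lambda>u. X u \<omega>) \<longlongrightarrow> l) (at_left t)"

locale subordinator = levy_process M S
  for M :: "'a measure" and S :: "real \<Rightarrow> 'a \<Rightarrow> real" +
  assumes nonneg_values: "AE \<omega> in M. \<forall>t\<ge>0. 0 \<le> S t \<omega>"
    and increasing: "AE \<omega> in M. \<forall>s t. 0 \<le> s \<longrightarrow> s \<le> t \<longrightarrow> S s \<omega> \<le> S t \<omega>"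

text \<open>
  This determines \<open>\<phi>\<close> uniquely on \<open>(0, \<infinity>)\<close>; values elsewhere are irrelevant.
  The representation \<open>\<phi> q = b * q + \<integral> (1 - exp (- q * s)) d\<mu>\<close> with drift \<open>b\<close> and Levy
  measure \<open>\<mu>\<close> holds for every subordinator and so is not part of the definition.
\<close>

definition is_laplace_exponent :: "'a measure \<Rightarrow> (real \<Rightarrow> 'a \<Rightarrow> real) \<Rightarrow> (real \<Rightarrow> real) \<Rightarrow> bool"
  where "is_laplace_exponent M S \<phi> \<longleftrightarrow>
    (\<forall>q>0. \<forall>t\<ge>0. (\<integral>\<omega>. exp (- q * S t \<omega>) \<partial>M) = exp (- t * \<phi> q))"

definition H_of :: "(real \<Rightarrow> real) \<Rightarrow> real \<Rightarrow> real"
  where "H_of \<phi> q = \<phi> q - q * deriv \<phi> q"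

end

theory Submission
  imports Defs "HOL-Real_Asymp.Real_Asymp"
begin

text \<open>
  The increments of \<open>S\<close> over \<open>n\<close> equal subintervals of \<open>[0, t]\<close> are i.i.d. copies of \<open>S (t / n)\<close>.
  Truncate each at level \<open>r\<close>. With \<open>q = 1 / r\<close>, the truncated sum has mean at most \<open>r e t \<phi>(q)\<close>,
  because \<open>min 1 x \<le> 2 (1 - exp (- x))\<close>, so Chebyshev's inequality and a union bound over the increments
  exceeding \<open>r\<close> bound the tail by \<open>2 n E (min 1 (q S (t / n)))\<^sup>2\<close>.  Up to a factor \<open>2 e\<close> this is at
  most \<open>n E g (q S (t / n))\<close> with \<open>g x = 1 - (1 + x) exp (- x)\<close>, which tends to \<open>t H(q)\<close> as \<open>n\<close> grows.
  Working with finite \<open>n\<close> and passing to the limit avoids the Levy-Khintchine representation.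
  The second assertion is the first one at level \<open>\<epsilon> r\<close>; the scaling bounds \<open>\<phi> (c q) \<le> c \<phi> q\<close>
  and \<open>H (c q) \<le> c\<^sup>2 H q\<close> for \<open>c \<ge> 1\<close> are inherited from \<open>1 - exp (- x)\<close> and \<open>g\<close>.
\<close>

section \<open>Elementary exponential inequalities\<close>

text \<open>This is the integral of y exp(-y) over [0, x], the Gamma(2) distribution function for
  \<open>x \<ge> 0\<close>. With drift b and Levy measure mu, the integral of
  \<open>exp_remainder (q * s)\<close> against mu(ds) is H(q), since the drift cancels in phi(q) - q
  phi'(q). This is why second moments of truncated increments are compared with it.\<close>

definition exp_remainder :: "real \<Rightarrow> real"
  where "exp_remainder x = 1 - (1 + x) * exp (- x)"

lemma exp_remainder_0 [simp]: "exp_remainder 0 = 0"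
  by (simp add: exp_remainder_def)

lemma DERIV_exp_remainder [derivative_intros]:
  assumes "(f has_field_derivative f') (at x within A)"
  shows "((\<lambda>x. exp_remainder (f x)) has_field_derivative f' * f x * exp (- f x)) (at x within A)"
  unfolding exp_remainder_def
  by (auto intro!: derivative_eq_intros assms simp: algebra_simps)

text \<open>From exp(-x) <= 1/(1+x) one gets 1 - exp(-x) >= x/(1+x), which is at least half of
  min(1, x). The factor 2 is good enough because it is absorbed later by 2 <= e.\<close>

lemma min_one_le_exp:
  fixes x :: real
  assumes "0 \<le> x"
  shows "min 1 x \<le> 2 * (1 - exp (- x))"
proof -
  have "exp (- x) \<le> inverse (1 + x)"
    using exp_ge_add_one_self[of x] assms by (simp add: exp_minus)
  then have "2 * (1 - inverse (1 + x)) \<le> 2 * (1 - exp (- x))"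
    by simp
  moreover have "min 1 x \<le> 2 * (1 - inverse (1 + x))"
    using assms mult_mono[of x 1 x x] by (auto simp: field_simps min_def)
  ultimately show ?thesis by linarith
qed

lemma nonneg_if_deriv_nonneg:
  fixes f f' :: "real \<Rightarrow> real"
  assumes "\<And>y. 0 \<le> y \<Longrightarrow> y \<le> x \<Longrightarrow> (f has_real_derivative f' y) (at y)"
    and "\<And>y. 0 \<le> y \<Longrightarrow> y \<le> x \<Longrightarrow> 0 \<le> f' y" and "f 0 = 0" and "0 \<le> x"
  shows "0 \<le> f x"
  using DERIV_nonneg_imp_nondecreasing[of 0 x f] assms by metis

text \<open>The difference of the two sides vanishes at 0 and has derivative c (exp(-x) - exp(-c x))
  >= 0.\<close>

lemma one_minus_exp_scale:
  fixes c x :: real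
  assumes "1 \<le> c" "0 \<le> x"
  shows "1 - exp (- (c * x)) \<le> c * (1 - exp (- x))"
proof -
  have "0 \<le> c * (1 - exp (- x)) - (1 - exp (- (c * x)))"
    by (rule nonneg_if_deriv_nonneg[where x = x and f = "\<lambda>x. c * (1 - exp (- x)) - (1 - exp (- (c * x)))"
          and f' = "\<lambda>x. c * exp (- x) - c * exp (- (c * x))"])
       (use assms in \<open>auto intro!: derivative_eq_intros simp: mult_le_cancel_right1\<close>)
  then show ?thesis by simp
qed

text \<open>The derivative of \<open>exp_remainder (c * x)\<close> in x is c^2 x exp(-c x), so the
  chain rule produces the square of c; what remains is the monotonicity of exp.\<close>

lemma exp_remainder_scale:
  assumes "1 \<le> c" "0 \<le> x"
  shows "exp_remainder (c * x) \<le> c\<^sup>2 * exp_remainder x"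
proof -
  have "0 \<le> c\<^sup>2 * exp_remainder x - exp_remainder (c * x)"
  proof (rule nonneg_if_deriv_nonneg[where x = x and f = "\<lambda>x. c\<^sup>2 * exp_remainder x - exp_remainder (c * x)"
        and f' = "\<lambda>x. c\<^sup>2 * x * (exp (- x) - exp (- (c * x)))"])
    fix y :: real assume y: "0 \<le> y"
    then have "exp (- (c * y)) \<le> exp (- y)"
      using assms by (simp add: mult_le_cancel_right1)
    then show "0 \<le> c\<^sup>2 * y * (exp (- y) - exp (- (c * y)))"
      using y by simp
  qed (use assms in \<open>auto intro!: derivative_eq_intros simp: algebra_simps power2_eq_square\<close>)
  then show ?thesis by simp
qed

text \<open>On [0, 1] the difference has derivative 2 y (exp(1 - y) - 1), nonnegative exactly
  because the constant is 2e. Beyond 1 the left side stays at 1 while \<open>exp_remainder\<close>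
  increases.\<close>

lemma min_one_sq_le_exp_remainder:
  assumes "0 \<le> x"
  shows "(min 1 x)\<^sup>2 \<le> 2 * exp 1 * exp_remainder x"
proof -
  have small: "y\<^sup>2 \<le> 2 * exp 1 * exp_remainder y" if "0 \<le> y" "y \<le> 1" for y
  proof -
    have "0 \<le> 2 * exp 1 * exp_remainder y - y\<^sup>2"
    proof (rule nonneg_if_deriv_nonneg[where x = y and f = "\<lambda>y. 2 * exp 1 * exp_remainder y - y\<^sup>2"
          and f' = "\<lambda>y. 2 * y * (exp (1 - y) - 1)"])
      fix z assume "0 \<le> z" "z \<le> y"
      with that show "0 \<le> 2 * z * (exp (1 - z) - 1)" by simp
    qed (use that in \<open>auto intro!: derivative_eq_intros simp: exp_diff exp_minus field_simps\<close>)
    then show ?thesis by simp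
  qed
  show ?thesis
  proof (cases "x \<le> 1")
    case True
    then show ?thesis using small[of x] assms by simp
  next
    case False
    have "exp_remainder 1 \<le> exp_remainder x"
      by (rule DERIV_nonneg_imp_nondecreasing)
         (use False in \<open>auto intro!: derivative_eq_intros exI\<close>)
    then have "2 * exp 1 * exp_remainder 1 \<le> 2 * exp 1 * exp_remainder x"
      by (intro mult_left_mono) auto
    moreover have "1 \<le> 2 * exp 1 * exp_remainder 1"
      using small[of 1] by simp
    ultimately have "1 \<le> 2 * exp 1 * exp_remainder x"
      by linarith
    then show ?thesis using False by simp
  qed
qed

text \<open>A second-order Taylor estimate in q whose constant does not depend on x. This uniformity
  is what allows differentiation under the expectation.\<close>

lemma exp_linearization_bound:
  fixes x q h :: real
  assumes x: "0 \<le> x" and q: "0 < q" and h: "\<bar>h\<bar> \<le> q / 2"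
  shows "\<bar>exp (- (q + h) * x) - exp (- q * x) + h * (x * exp (- q * x))\<bar> \<le> 16 / q\<^sup>2 * h\<^sup>2"
proof -
  \<comment> \<open>Since |h| <= q/2, both exponents are at least (q/2) x, so m dominates a and
    b.\<close>
  define a b m where "a = exp (- q * x)" and "b = exp (- (q + h) * x)" and "m = exp (- (q / 2) * x)"
  have ba: "b = a * exp (- (h * x))" and ab: "a = b * exp (h * x)"
    by (simp_all add: a_def b_def algebra_simps flip: exp_add)
  have 1: "a * (1 - h * x) \<le> b"
    unfolding ba using exp_ge_add_one_self[of "- (h * x)"] by (intro mult_left_mono) (auto simp: a_def)
  have 2: "b * (1 + h * x) \<le> a"
    unfolding ab using exp_ge_add_one_self[of "h * x"] by (intro mult_left_mono) (auto simp: b_def)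
  have "q / 2 * x \<le> q * x" "q / 2 * x \<le> (q + h) * x"
    using x q h by (intro mult_right_mono; linarith)+
  then have "a \<le> m" "b \<le> m"
    unfolding a_def b_def m_def mult_minus_left exp_le_cancel_iff by linarith+
  \<comment> \<open>Fact 1 says that the quantity inside the modulus is nonnegative; fact 2,
    rearranged, bounds it above by h x (a - b).\<close>
  have "\<bar>b - a + h * (x * a)\<bar> \<le> h * x * (a - b)"
    using 1 2 by (simp add: algebra_simps)
  also have "\<dots> \<le> (h * x)\<^sup>2 * m"
  \<comment> \<open>For h >= 0, fact 1 gives a - b <= h x a; for h < 0, fact 2 gives b - a <= (-h) x
    b. Either way a second factor h x appears.\<close>
  proof (cases "0 \<le> h")
    case True
    have "h * x * (a - b) \<le> h * x * (h * x * a)"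
      using 1 True x by (intro mult_left_mono) (auto simp: algebra_simps)
    also have "\<dots> \<le> h * x * (h * x * m)"
      using True x \<open>a \<le> m\<close> by (intro mult_left_mono) auto
    finally show ?thesis by (simp add: power2_eq_square algebra_simps)
  next
    case False
    have "(- h) * x * (b - a) \<le> (- h) * x * ((- h) * x * b)"
      using 2 False x by (intro mult_left_mono) (auto simp: algebra_simps mult_nonpos_nonneg)
    also have "\<dots> \<le> (- h) * x * ((- h) * x * m)"
      using False x \<open>b \<le> m\<close> by (intro mult_left_mono) (auto simp: mult_nonpos_nonneg)
    finally show ?thesis by (simp add: power2_eq_square algebra_simps)
  qed
  also have "\<dots> \<le> 16 / q\<^sup>2 * h\<^sup>2"
  proof -
    \<comment> \<open>Squaring u <= exp(u) at u = q x / 4 gives u^2 <= exp(q x / 2) = 1/m; hence the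
      constant 16.\<close>
    have "(q * x / 4)\<^sup>2 \<le> (exp (q * x / 4))\<^sup>2"
      using exp_ge_add_one_self[of "q * x / 4"] x q
      by (intro power_mono) (auto simp del: exp_ge_add_one_self)
    also have "\<dots> = exp (q * x / 2)"
      by (simp add: power2_eq_square flip: exp_add)
    finally have "(q * x / 4)\<^sup>2 * m \<le> exp (q * x / 2) * m"
      by (intro mult_right_mono) (auto simp: m_def)
    also have "\<dots> = 1"
      by (simp add: m_def flip: exp_add)
    finally have "x\<^sup>2 * m \<le> 16 / q\<^sup>2"
      using q by (simp add: field_simps power2_eq_square)
    then have "x\<^sup>2 * m * h\<^sup>2 \<le> 16 / q\<^sup>2 * h\<^sup>2"
      by (intro mult_right_mono) auto
    then show ?thesis by (simp add: power_mult_distrib algebra_simps)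
  qed
  finally show ?thesis by (simp add: a_def b_def)
qed

section \<open>Laplace transforms and truncated sums\<close>

context prob_space
begin

section \<open>Integrability and differentiation of Laplace transforms\<close>

lemma
  fixes X :: "'a \<Rightarrow> real"
  assumes X [measurable]: "random_variable borel X" and nonneg: "AE \<omega> in M. 0 \<le> X \<omega>"
  shows integrable_exp_uminus: "0 \<le> q \<Longrightarrow> integrable M (\<lambda>\<omega>. exp (- q * X \<omega>))"
    and integrable_mult_exp_uminus: "0 < q \<Longrightarrow> integrable M (\<lambda>\<omega>. X \<omega> * exp (- q * X \<omega>))"
proof -
  show "integrable M (\<lambda>\<omega>. exp (- q * X \<omega>))" if "0 \<le> q"
    by (rule integrable_const_bound[where B = 1]) (use nonneg that in auto)
  show "integrable M (\<lambda>\<omega>. X \<omega> * exp (- q * X \<omega>))" if "0 < q"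
  proof (rule integrable_const_bound[where B = "1 / q"])
    \<comment> \<open>This is q x <= exp(q x), divided by q exp(q x).\<close>
    have "norm (x * exp (- q * x)) \<le> 1 / q" if "0 \<le> x" for x
      using exp_ge_add_one_self[of "q * x"] that \<open>0 < q\<close>
      by (simp add: exp_minus field_simps del: exp_ge_add_one_self)
    then show "AE \<omega> in M. norm (X \<omega> * exp (- q * X \<omega>)) \<le> 1 / q"
      using nonneg by auto
  qed simp
qed

text \<open>X itself may have infinite mean; for q > 0 the exponential factor makes the derivative
  integrable. Integrating the uniform quadratic remainder and dividing by h leaves an error of order
  |h|.\<close>

lemma laplace_transform_has_derivative:
  fixes X :: "'a \<Rightarrow> real"
  assumes X [measurable]: "random_variable borel X" and nonneg: "AE \<omega> in M. 0 \<le> X \<omega>"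
    and q: "0 < q"
  shows "((\<lambda>q. expectation (\<lambda>\<omega>. exp (- q * X \<omega>))) has_real_derivative
           - expectation (\<lambda>\<omega>. X \<omega> * exp (- q * X \<omega>))) (at q)"
proof -
  let ?F = "\<lambda>q. expectation (\<lambda>\<omega>. exp (- q * X \<omega>))"
  let ?G = "expectation (\<lambda>\<omega>. X \<omega> * exp (- q * X \<omega>))"
  note int = integrable_exp_uminus[OF X nonneg] integrable_mult_exp_uminus[OF X nonneg]
  have bound: "\<bar>?F (q + h) - ?F q + h * ?G\<bar> \<le> 16 / q\<^sup>2 * h\<^sup>2" if h: "\<bar>h\<bar> \<le> q / 2" for h
  proof -
    have h': "0 \<le> q + h" using h q by (simp add: abs_le_iff)
    let ?D = "\<lambda>\<omega>. exp (- (q + h) * X \<omega>) - exp (- q * X \<omega>) + h * (X \<omega> * exp (- q * X \<omega>))"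
    have intD: "integrable M ?D"
      using h' q by (intro Bochner_Integration.integrable_add Bochner_Integration.integrable_diff
          integrable_mult_right int) auto
    have "\<bar>?F (q + h) - ?F q + h * ?G\<bar> = \<bar>expectation ?D\<bar>"
      using h' q int(1)[of "q + h"] int(1)[of q] int(2)[of q] by simp
    also have "\<dots> \<le> expectation (\<lambda>\<omega>. \<bar>?D \<omega>\<bar>)"
      by (rule integral_abs_bound)
    also have "\<dots> \<le> expectation (\<lambda>_. 16 / q\<^sup>2 * h\<^sup>2)"
    proof (rule integral_mono_AE)
      show "integrable M (\<lambda>\<omega>. \<bar>?D \<omega>\<bar>)"
        using intD by (rule integrable_abs)
      show "AE \<omega> in M. \<bar>?D \<omega>\<bar> \<le> 16 / q\<^sup>2 * h\<^sup>2"
        using nonneg by eventually_elim (rule exp_linearization_bound[OF _ q h])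
    qed simp
    finally show ?thesis by (simp add: prob_space)
  qed
  have "((\<lambda>h. (?F (q + h) - ?F q) / h - (- ?G)) \<longlongrightarrow> 0) (at 0)"
  proof (rule Lim_null_comparison[where g = "\<lambda>h. 16 / q\<^sup>2 * \<bar>h\<bar>"])
    have "eventually (\<lambda>h. h \<in> {- (q / 2)<..<q / 2}) (at 0)"
      using q by (intro eventually_at_in_open') auto
    moreover have "eventually (\<lambda>h. h \<noteq> (0::real)) (at 0)"
      by (simp add: eventually_at_filter)
    ultimately show "eventually (\<lambda>h. norm ((?F (q + h) - ?F q) / h - (- ?G)) \<le> 16 / q\<^sup>2 * \<bar>h\<bar>) (at 0)"
    proof eventually_elim
      case (elim h)
      then have eq: "(?F (q + h) - ?F q) / h - (- ?G) = (?F (q + h) - ?F q + h * ?G) / h"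
        by (simp add: field_simps)
      have "norm ((?F (q + h) - ?F q) / h - (- ?G)) \<le> 16 / q\<^sup>2 * h\<^sup>2 / \<bar>h\<bar>"
        unfolding eq real_norm_def abs_divide using elim by (intro divide_right_mono bound) auto
      also have "\<dots> = 16 / q\<^sup>2 * \<bar>h\<bar>"
        using elim by (simp add: power2_eq_square field_simps flip: abs_mult)
      finally show ?case .
    qed
    show "((\<lambda>h. 16 / q\<^sup>2 * \<bar>h\<bar>) \<longlongrightarrow> 0) (at 0)"
      using q by (auto intro!: tendsto_eq_intros)
  qed
  then show ?thesis
    unfolding DERIV_def by (subst (asm) LIM_zero_iff) simp
qed

section \<open>Variance and upper tail of sums of independent variables\<close>

lemma variance_sum_indep:
  fixes X :: "'i \<Rightarrow> 'a \<Rightarrow> real"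
  assumes I: "finite I" and indep: "indep_vars (\<lambda>_. borel) X I"
    and sq: "\<And>i. i \<in> I \<Longrightarrow> integrable M (\<lambda>\<omega>. (X i \<omega>)\<^sup>2)"
  shows "variance (\<lambda>\<omega>. \<Sum>i\<in>I. X i \<omega>) = (\<Sum>i\<in>I. variance (X i))"
proof -
  have [measurable]: "random_variable borel (X i)" if "i \<in> I" for i
    using indep that by (simp add: indep_vars_def2)
  have int: "integrable M (X i)" if "i \<in> I" for i
    using that sq[OF that] by (auto intro: square_integrable_imp_integrable)
  define Z where "Z i \<omega> = X i \<omega> - expectation (X i)" for i \<omega>
  have Z [measurable]: "random_variable borel (Z i)" if "i \<in> I" for i
    using that unfolding Z_def by measurable
  have Zint: "integrable M (Z i)" and Z0: "expectation (Z i) = 0" if "i \<in> I" for i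
    using int[OF that] by (simp_all add: Z_def[abs_def] prob_space)
  have Zsq: "integrable M (\<lambda>\<omega>. (Z i \<omega>)\<^sup>2)" if "i \<in> I" for i
    using int[OF that] sq[OF that] by (simp add: Z_def power2_diff)
  have Zprod: "integrable M (\<lambda>\<omega>. Z i \<omega> * Z j \<omega>)" if "i \<in> I" "j \<in> I" for i j
  proof (rule Bochner_Integration.integrable_bound)
    show "integrable M (\<lambda>\<omega>. (Z i \<omega>)\<^sup>2 + (Z j \<omega>)\<^sup>2)"
      using that Zsq by auto
    have "norm (x * y) \<le> norm (x\<^sup>2 + y\<^sup>2)" for x y :: real
    proof -
      have "\<bar>x\<bar> * \<bar>y\<bar> \<le> 2 * \<bar>x\<bar> * \<bar>y\<bar>" by simp
      also have "\<dots> \<le> x\<^sup>2 + y\<^sup>2"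
        using sum_squares_bound[of "\<bar>x\<bar>" "\<bar>y\<bar>"] by simp
      finally show ?thesis by (simp add: abs_mult)
    qed
    then show "AE \<omega> in M. norm (Z i \<omega> * Z j \<omega>) \<le> norm ((Z i \<omega>)\<^sup>2 + (Z j \<omega>)\<^sup>2)"
      by simp
  qed (use that in measurable)
  \<comment> \<open>Independence makes the centred variables orthogonal, so only the diagonal of the
    double sum below survives.\<close>
  have orth: "expectation (\<lambda>\<omega>. Z i \<omega> * Z j \<omega>) = 0" if "i \<in> I" "j \<in> I" "i \<noteq> j" for i j
  proof -
    have "indep_vars (\<lambda>_. borel) Z I"
      using indep_vars_compose2[OF indep, of "\<lambda>i x. x - expectation (X i)" "\<lambda>_. borel"]
      by (simp add: Z_def[abs_def])
    then have "indep_vars (\<lambda>_. borel) Z {i, j}"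
      by (rule indep_vars_subset) (use that in auto)
    then have "expectation (\<lambda>\<omega>. \<Prod>k\<in>{i, j}. Z k \<omega>) = (\<Prod>k\<in>{i, j}. expectation (Z k))"
      using that Zint by (intro indep_vars_lebesgue_integral) auto
    then show ?thesis using that Z0 by simp
  qed
  have "variance (\<lambda>\<omega>. \<Sum>i\<in>I. X i \<omega>) = expectation (\<lambda>\<omega>. (\<Sum>i\<in>I. Z i \<omega>)\<^sup>2)"
    using int by (simp add: Z_def sum_subtractf)
  also have "\<dots> = expectation (\<lambda>\<omega>. \<Sum>i\<in>I. \<Sum>j\<in>I. Z i \<omega> * Z j \<omega>)"
    by (simp add: power2_eq_square sum_product)
  also have "\<dots> = (\<Sum>i\<in>I. \<Sum>j\<in>I. expectation (\<lambda>\<omega>. Z i \<omega> * Z j \<omega>))"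
    using Zprod by (subst Bochner_Integration.integral_sum; (intro sum.cong Bochner_Integration.integrable_sum)?; simp?)
  also have "\<dots> = (\<Sum>i\<in>I. \<Sum>j\<in>I. if i = j then expectation (\<lambda>\<omega>. (Z i \<omega>)\<^sup>2) else 0)"
    using orth by (intro sum.cong refl) (auto simp: power2_eq_square)
  also have "\<dots> = (\<Sum>i\<in>I. variance (X i))"
    using I by (simp add: Z_def)
  finally show ?thesis .
qed

text \<open>Either some summand reaches 1, or the sum equals its truncated version T and T exceeds
  its mean by at least 1. The union bound and Chebyshev's inequality each cost the sum of the
  truncated second moments, hence the factor 2.\<close>

lemma prob_sum_ge_truncated:
  fixes X :: "'i \<Rightarrow> 'a \<Rightarrow> real"
  assumes I: "finite I" and indep: "indep_vars (\<lambda>_. borel) X I"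
    and nonneg: "\<And>i. i \<in> I \<Longrightarrow> AE \<omega> in M. 0 \<le> X i \<omega>"
  shows "prob {\<omega> \<in> space M. 1 + (\<Sum>i\<in>I. expectation (\<lambda>\<omega>. min 1 (X i \<omega>))) \<le> (\<Sum>i\<in>I. X i \<omega>)}
           \<le> 2 * (\<Sum>i\<in>I. expectation (\<lambda>\<omega>. (min 1 (X i \<omega>))\<^sup>2))"
proof -
  define Y where "Y i \<omega> = min 1 (X i \<omega>)" for i \<omega>
  have X [measurable]: "random_variable borel (X i)" if "i \<in> I" for i
    using indep that by (simp add: indep_vars_def2)
  have Y [measurable]: "random_variable borel (Y i)" if "i \<in> I" for i
    using that unfolding Y_def by measurable
  have Yint: "integrable M (Y i)" and Ysq: "integrable M (\<lambda>\<omega>. (Y i \<omega>)\<^sup>2)" if "i \<in> I" for i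
    using nonneg[OF that] that
    by (auto intro!: integrable_const_bound[where B = 1] simp: Y_def power_le_one)
  have Yindep: "indep_vars (\<lambda>_. borel) Y I"
    using indep_vars_compose2[OF indep, of "\<lambda>_ x. min 1 x" "\<lambda>_. borel"] by (simp add: Y_def[abs_def])
  define T where "T \<omega> = (\<Sum>i\<in>I. Y i \<omega>)" for \<omega>
  have T [measurable]: "random_variable borel T"
    unfolding T_def by measurable
  have ET: "expectation T = (\<Sum>i\<in>I. expectation (Y i))"
    unfolding T_def using Yint by simp
  have Tint: "integrable M (\<lambda>\<omega>. (T \<omega>)\<^sup>2)"
  proof (rule integrable_const_bound[where B = "(real (card I))\<^sup>2"])
    have "AE \<omega> in M. \<forall>i\<in>I. 0 \<le> X i \<omega>"
      using nonneg I by (simp add: AE_finite_all)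
    then show "AE \<omega> in M. norm ((T \<omega>)\<^sup>2) \<le> (real (card I))\<^sup>2"
    proof eventually_elim
      case (elim \<omega>)
      then have "0 \<le> T \<omega>" "T \<omega> \<le> (\<Sum>i\<in>I. 1)"
        unfolding T_def Y_def by (intro sum_nonneg; simp) (intro sum_mono; simp)
      then show ?case by (simp add: power_mono)
    qed
  qed simp
  have dev: "prob {\<omega> \<in> space M. 1 \<le> \<bar>T \<omega> - expectation T\<bar>} \<le> (\<Sum>i\<in>I. expectation (\<lambda>\<omega>. (Y i \<omega>)\<^sup>2))"
  proof -
    have "prob {\<omega> \<in> space M. 1 \<le> \<bar>T \<omega> - expectation T\<bar>} \<le> variance T"
      using Chebyshev_inequality[OF T Tint, of 1] by simp
    also have "\<dots> = (\<Sum>i\<in>I. variance (Y i))"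
      unfolding T_def by (rule variance_sum_indep[OF I Yindep Ysq])
    also have "\<dots> \<le> (\<Sum>i\<in>I. expectation (\<lambda>\<omega>. (Y i \<omega>)\<^sup>2))"
      using Yint Ysq by (intro sum_mono) (simp add: variance_eq)
    finally show ?thesis .
  qed
  \<comment> \<open>X_i >= 1 forces Y_i = 1, so Markov's inequality for Y_i^2 applies.\<close>
  have big: "prob {\<omega> \<in> space M. 1 \<le> X i \<omega>} \<le> expectation (\<lambda>\<omega>. (Y i \<omega>)\<^sup>2)" if i: "i \<in> I" for i
  proof -
    have "prob {\<omega> \<in> space M. 1 \<le> X i \<omega>} \<le> prob {\<omega> \<in> space M. 1 \<le> (Y i \<omega>)\<^sup>2}"
      using i by (intro finite_measure_mono) (auto simp: Y_def)
    also have "\<dots> \<le> expectation (\<lambda>\<omega>. (Y i \<omega>)\<^sup>2) / 1"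
      by (rule integral_Markov_inequality_measure[OF Ysq[OF i] sets.top]) auto
    finally show ?thesis by simp
  qed
  have "prob {\<omega> \<in> space M. 1 + expectation T \<le> (\<Sum>i\<in>I. X i \<omega>)}
      \<le> prob ({\<omega> \<in> space M. 1 \<le> \<bar>T \<omega> - expectation T\<bar>} \<union> (\<Union>i\<in>I. {\<omega> \<in> space M. 1 \<le> X i \<omega>}))"
  proof (rule finite_measure_mono)
    show "{\<omega> \<in> space M. 1 + expectation T \<le> (\<Sum>i\<in>I. X i \<omega>)}
      \<subseteq> {\<omega> \<in> space M. 1 \<le> \<bar>T \<omega> - expectation T\<bar>} \<union> (\<Union>i\<in>I. {\<omega> \<in> space M. 1 \<le> X i \<omega>})"
    proof safe
      fix \<omega> assume *: "1 + expectation T \<le> (\<Sum>i\<in>I. X i \<omega>)" "\<omega> \<notin> (\<Union>i\<in>I. {\<omega> \<in> space M. 1 \<le> X i \<omega>})"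
        "\<omega> \<in> space M"
      then have "T \<omega> = (\<Sum>i\<in>I. X i \<omega>)"
        unfolding T_def Y_def by (intro sum.cong) auto
      then show "1 \<le> \<bar>T \<omega> - expectation T\<bar>"
        using * by simp
    qed
    have "(\<Union>i\<in>I. {\<omega> \<in> space M. 1 \<le> X i \<omega>}) \<in> events"
      using I by (intro sets.finite_UN) auto
    then show "{\<omega> \<in> space M. 1 \<le> \<bar>T \<omega> - expectation T\<bar>} \<union> (\<Union>i\<in>I. {\<omega> \<in> space M. 1 \<le> X i \<omega>}) \<in> events"
      by (intro sets.Un) auto
  qed
  also have "\<dots> \<le> prob {\<omega> \<in> space M. 1 \<le> \<bar>T \<omega> - expectation T\<bar>} + prob (\<Union>i\<in>I. {\<omega> \<in> space M. 1 \<le> X i \<omega>})"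
    using I by (intro measure_Un_le sets.finite_UN) auto
  also have "prob (\<Union>i\<in>I. {\<omega> \<in> space M. 1 \<le> X i \<omega>}) \<le> (\<Sum>i\<in>I. prob {\<omega> \<in> space M. 1 \<le> X i \<omega>})"
    using I by (intro measure_subadditive_finite) auto
  also have "\<dots> \<le> (\<Sum>i\<in>I. expectation (\<lambda>\<omega>. (Y i \<omega>)\<^sup>2))"
    using big by (intro sum_mono)
  finally show ?thesis
    using dev unfolding ET Y_def by linarith
qed

end

section \<open>Subordinators\<close>

locale subordinator_laplace = subordinator M S
  for M :: "'a measure" and S :: "real \<Rightarrow> 'a \<Rightarrow> real" +
  fixes \<phi> :: "real \<Rightarrow> real"
  assumes laplace_exponent: "is_laplace_exponent M S \<phi>"
begin

section \<open>Increments of S and the discretised tail bound\<close>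

lemma AE_nonneg: "0 \<le> t \<Longrightarrow> AE \<omega> in M. 0 \<le> S t \<omega>"
  using nonneg_values by auto

lemma expectation_exp:
  "0 < q \<Longrightarrow> 0 \<le> t \<Longrightarrow> expectation (\<lambda>\<omega>. exp (- q * S t \<omega>)) = exp (- t * \<phi> q)"
  using laplace_exponent unfolding is_laplace_exponent_def by blast

lemma expectation_increment:
  fixes f :: "real \<Rightarrow> real"
  assumes [measurable]: "f \<in> borel_measurable borel" and "0 \<le> s" "0 \<le> h"
  shows "expectation (\<lambda>\<omega>. f (S (s + h) \<omega> - S s \<omega>)) = expectation (\<lambda>\<omega>. f (S h \<omega>))"
proof -
  have [measurable]: "random_variable borel (S (s + h))" "random_variable borel (S s)"
      "random_variable borel (S h)"
    using assms by (auto intro: random_variable_at)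
  have "expectation (\<lambda>\<omega>. f (S (s + h) \<omega> - S s \<omega>)) =
      integral\<^sup>L (distr M borel (\<lambda>\<omega>. S (s + h) \<omega> - S s \<omega>)) f"
    by (rule integral_distr[symmetric]) auto
  also have "\<dots> = integral\<^sup>L (distr M borel (S h)) f"
    using assms by (simp add: stationary_increments)
  also have "\<dots> = expectation (\<lambda>\<omega>. f (S h \<omega>))"
    by (rule integral_distr) auto
  finally show ?thesis .
qed

lemma prob_ge_discretised:
  assumes q: "0 < q" and t: "0 \<le> t" and n: "0 < (n::nat)"
  shows "prob {\<omega> \<in> space M. 1 + n * expectation (\<lambda>\<omega>. min 1 (q * S (t / n) \<omega>)) \<le> q * S t \<omega>}
           \<le> 2 * (n * expectation (\<lambda>\<omega>. (min 1 (q * S (t / n) \<omega>))\<^sup>2))"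
proof -
  define \<tau> where "\<tau> i = i * (t / n)" for i :: nat
  have \<tau>_nonneg: "0 \<le> \<tau> i" for i
    using t by (simp add: \<tau>_def)
  have \<tau>_Suc: "\<tau> (Suc i) = \<tau> i + t / n" for i
    by (simp add: \<tau>_def algebra_simps add_divide_distrib)
  have \<tau>_0: "\<tau> 0 = 0" and \<tau>_n: "\<tau> n = t"
    using n by (simp_all add: \<tau>_def)
  have \<tau>_mono: "\<tau> i \<le> \<tau> (Suc i)" for i
    using t by (simp add: \<tau>_Suc)
  have h: "0 \<le> t / n" using t by simp
  define X where "X i \<omega> = q * (S (\<tau> (Suc i)) \<omega> - S (\<tau> i) \<omega>)" for i \<omega>
  have S [measurable]: "random_variable borel (S (\<tau> i))" "random_variable borel (S t)" for i
    using \<tau>_nonneg t by (auto intro: random_variable_at)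
  have X [measurable]: "random_variable borel (X i)" for i
    unfolding X_def by measurable
  have "indep_vars (\<lambda>_. borel) (\<lambda>i \<omega>. S (\<tau> (Suc i)) \<omega> - S (\<tau> i) \<omega>) {..<n}"
    by (rule indep_increments) (use \<tau>_nonneg \<tau>_mono in auto)
  from indep_vars_compose2[OF this, of "\<lambda>_ x. q * x" "\<lambda>_. borel"]
  have indep: "indep_vars (\<lambda>_. borel) X {..<n}"
    by (simp add: X_def[abs_def])
  have nonneg: "AE \<omega> in M. 0 \<le> X i \<omega>" for i
    using increasing by eventually_elim (use \<tau>_nonneg \<tau>_mono q in \<open>auto simp: X_def\<close>)
  have E1: "expectation (\<lambda>\<omega>. min 1 (X i \<omega>)) = expectation (\<lambda>\<omega>. min 1 (q * S (t / n) \<omega>))" for i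
    unfolding X_def \<tau>_Suc by (rule expectation_increment[OF _ \<tau>_nonneg h]) simp
  have E2: "expectation (\<lambda>\<omega>. (min 1 (X i \<omega>))\<^sup>2) = expectation (\<lambda>\<omega>. (min 1 (q * S (t / n) \<omega>))\<^sup>2)" for i
    unfolding X_def \<tau>_Suc by (rule expectation_increment[OF _ \<tau>_nonneg h]) simp
  have sum_X: "(\<Sum>i<n. X i \<omega>) = q * (S t \<omega> - S 0 \<omega>)" for \<omega>
    using sum_lessThan_telescope[of "\<lambda>i. S (\<tau> i) \<omega>" n]
    by (simp add: X_def \<tau>_0 \<tau>_n flip: sum_distrib_left)
  \<comment> \<open>The increments telescope to q (S_t - S_0), and S_0 = 0 holds only almost surely,
    so the two events agree up to a null set.\<close>
  have "prob {\<omega> \<in> space M. 1 + n * expectation (\<lambda>\<omega>. min 1 (q * S (t / n) \<omega>)) \<le> q * S t \<omega>}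
      = prob {\<omega> \<in> space M. 1 + (\<Sum>i<n. expectation (\<lambda>\<omega>. min 1 (X i \<omega>))) \<le> (\<Sum>i<n. X i \<omega>)}"
    using starts_at_0 \<tau>_0 S(1)[of 0] by (intro prob_eq_AE) (auto simp: E1 sum_X)
  also have "\<dots> \<le> 2 * (\<Sum>i<n. expectation (\<lambda>\<omega>. (min 1 (X i \<omega>))\<^sup>2))"
    by (rule prob_sum_ge_truncated[OF _ indep nonneg]) simp
  finally show ?thesis by (simp add: E2)
qed

section \<open>Sign and derivative of the Laplace exponent, and exponential moments of S\<close>

lemma exponent_nonneg:
  assumes "0 < q" shows "0 \<le> \<phi> q"
proof -
  have "expectation (\<lambda>\<omega>. exp (- q * S 1 \<omega>)) \<le> expectation (\<lambda>_. 1)"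
    using assms AE_nonneg[of 1]
    by (intro integral_mono_AE integrable_exp_uminus random_variable_at) auto
  then show ?thesis
    using expectation_exp[OF assms, of 1] by (simp add: prob_space)
qed

text \<open>Differentiability of \<open>\<phi>\<close> is not assumed, yet \<open>H_of\<close> is
  meaningful only if \<open>deriv\<close> is a true derivative. It follows because
  \<open>\<phi>\<close> is minus the logarithm of the Laplace transform of S_1.\<close>

lemma exponent_has_derivative:
  assumes "0 < q" shows "(\<phi> has_real_derivative deriv \<phi> q) (at q)"
proof -
  let ?F = "\<lambda>q. expectation (\<lambda>\<omega>. exp (- q * S 1 \<omega>))"
  have F: "?F x = exp (- \<phi> x)" if "0 < x" for x
    using expectation_exp[OF that, of 1] by simp
  have F': "(?F has_real_derivative - expectation (\<lambda>\<omega>. S 1 \<omega> * exp (- q * S 1 \<omega>))) (at q)"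
    using assms by (intro laplace_transform_has_derivative random_variable_at AE_nonneg) auto
  have pos: "0 < ?F q" using F[OF assms] by simp
  obtain D where "((\<lambda>x. - ln (?F x)) has_real_derivative D) (at q)"
    using DERIV_minus[OF DERIV_chain2[OF DERIV_ln_divide[OF pos] F']] by blast
  \<comment> \<open>Values of \<open>\<phi>\<close> outside (0, oo) are arbitrary, so the two
    functions are identified only on a neighbourhood of q.\<close>
  moreover have "(\<phi> has_real_derivative D) (at q) \<longleftrightarrow> ((\<lambda>x. - ln (?F x)) has_real_derivative D) (at q)"
    by (rule DERIV_cong_ev)
       (use assms F in \<open>auto intro!: eventually_mono[OF eventually_nhds_in_open[of "{0<..}"]]\<close>)
  ultimately show ?thesis
    using DERIV_imp_deriv by blast
qed

text \<open>Both sides of E exp(-q S_t) = exp(-t phi(q)) are differentiated in q, and the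
  derivatives are compared.\<close>

lemma expectation_mult_exp:
  assumes q: "0 < q" and t: "0 \<le> t"
  shows "expectation (\<lambda>\<omega>. S t \<omega> * exp (- q * S t \<omega>)) = t * deriv \<phi> q * exp (- t * \<phi> q)"
proof -
  let ?F = "\<lambda>q. expectation (\<lambda>\<omega>. exp (- q * S t \<omega>))"
  have "(?F has_real_derivative - expectation (\<lambda>\<omega>. S t \<omega> * exp (- q * S t \<omega>))) (at q)"
    using assms by (intro laplace_transform_has_derivative random_variable_at AE_nonneg)
  moreover have "(?F has_real_derivative - (t * deriv \<phi> q * exp (- t * \<phi> q))) (at q)
      \<longleftrightarrow> ((\<lambda>x. exp (- t * \<phi> x)) has_real_derivative - (t * deriv \<phi> q * exp (- t * \<phi> q))) (at q)"
    by (rule DERIV_cong_ev)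
       (use assms expectation_exp in \<open>auto intro!: eventually_mono[OF eventually_nhds_in_open[of "{0<..}"]]\<close>)
  moreover have "((\<lambda>x. exp (- t * \<phi> x)) has_real_derivative - (t * deriv \<phi> q * exp (- t * \<phi> q))) (at q)"
    using exponent_has_derivative[OF q] by (auto intro!: derivative_eq_intros)
  ultimately show ?thesis
    using DERIV_unique by fastforce
qed

lemma integrable_exp_remainder:
  assumes q: "0 < q" and t: "0 \<le> t"
  shows "integrable M (\<lambda>\<omega>. exp_remainder (q * S t \<omega>))"
    and expectation_exp_remainder: "expectation (\<lambda>\<omega>. exp_remainder (q * S t \<omega>)) =
      1 - exp (- t * \<phi> q) - t * (q * deriv \<phi> q) * exp (- t * \<phi> q)"
proof -
  have eq: "exp_remainder (q * S t \<omega>) = 1 - exp (- q * S t \<omega>) - q * (S t \<omega> * exp (- q * S t \<omega>))" for \<omega>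
    by (simp add: exp_remainder_def algebra_simps)
  have int: "integrable M (\<lambda>\<omega>. exp (- q * S t \<omega>))" "integrable M (\<lambda>\<omega>. S t \<omega> * exp (- q * S t \<omega>))"
    using q t by (intro integrable_exp_uminus integrable_mult_exp_uminus random_variable_at AE_nonneg; simp)+
  show "integrable M (\<lambda>\<omega>. exp_remainder (q * S t \<omega>))"
    unfolding eq using int by (intro Bochner_Integration.integrable_diff integrable_mult_right) auto
  have "expectation (\<lambda>\<omega>. exp_remainder (q * S t \<omega>)) =
      1 - expectation (\<lambda>\<omega>. exp (- q * S t \<omega>)) - q * expectation (\<lambda>\<omega>. S t \<omega> * exp (- q * S t \<omega>))"
    unfolding eq using int by (simp add: prob_space)
  then show "expectation (\<lambda>\<omega>. exp_remainder (q * S t \<omega>)) =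
      1 - exp (- t * \<phi> q) - t * (q * deriv \<phi> q) * exp (- t * \<phi> q)"
    unfolding expectation_exp[OF assms] expectation_mult_exp[OF assms] by (simp add: algebra_simps)
qed

section \<open>Small-time limits and scaling of phi and H\<close>

lemma LIMSEQ_one_minus_exp: "(\<lambda>n. n * (1 - exp (- (t / n) * a))) \<longlonglongrightarrow> t * a"
  for t a :: real
  by (cases "t * a" "0::real" rule: linorder_cases; real_asymp)

text \<open>In the explicit formula for the expectation at time t/n, multiplied by n, the first part
  tends to t phi(q) and the second to t q phi'(q).\<close>

lemma LIMSEQ_exp_remainder:
  assumes q: "0 < q" and t: "0 \<le> t"
  shows "(\<lambda>n. n * expectation (\<lambda>\<omega>. exp_remainder (q * S (t / n) \<omega>))) \<longlonglongrightarrow> t * H_of \<phi> q"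
proof -
  have "(\<lambda>n. t * (q * deriv \<phi> q) * exp (- (t / real n) * \<phi> q)) \<longlonglongrightarrow> t * (q * deriv \<phi> q) * exp (- 0 * \<phi> q)"
    by (intro tendsto_intros lim_const_over_n)
  from tendsto_diff[OF LIMSEQ_one_minus_exp[of t "\<phi> q"] this]
  have "(\<lambda>n. n * (1 - exp (- (t / n) * \<phi> q)) - t * (q * deriv \<phi> q) * exp (- (t / real n) * \<phi> q)) \<longlonglongrightarrow> t * H_of \<phi> q"
    by (simp add: H_of_def algebra_simps)
  then show ?thesis
  proof (rule Lim_transform_eventually)
    \<comment> \<open>n = 0 must be excluded for n (t/n) to cancel to t.\<close>
    show "eventually (\<lambda>n. n * (1 - exp (- (t / n) * \<phi> q)) - t * (q * deriv \<phi> q) * exp (- (t / real n) * \<phi> q)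
      = n * expectation (\<lambda>\<omega>. exp_remainder (q * S (t / n) \<omega>))) sequentially"
      using eventually_gt_at_top[of 0]
      by eventually_elim
         (use q t in \<open>simp add: expectation_exp_remainder field_simps\<close>)
  qed
qed

text \<open>phi(q) is the limit of n E(1 - exp(-q S_{1/n})), so the pointwise bound
  \<open>one_minus_exp_scale\<close> passes through the expectation and the limit.\<close>

lemma exponent_scale:
  assumes q: "0 < q" and c: "1 \<le> c"
  shows "\<phi> (c * q) \<le> c * \<phi> q"
proof -
  have "1 * \<phi> (c * q) \<le> c * (1 * \<phi> q)"
  proof (rule LIMSEQ_le)
    show "(\<lambda>n. n * (1 - exp (- (1 / n) * \<phi> (c * q)))) \<longlonglongrightarrow> 1 * \<phi> (c * q)"
      by (rule LIMSEQ_one_minus_exp)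
    show "(\<lambda>n. c * (n * (1 - exp (- (1 / n) * \<phi> q)))) \<longlonglongrightarrow> c * (1 * \<phi> q)"
      by (intro tendsto_mult_left LIMSEQ_one_minus_exp)
    \<comment> \<open>The case n = 0 is covered as well: 1/0 is 0, and the outer factor makes both
      sides 0.\<close>
    have "n * (1 - exp (- (1 / n) * \<phi> (c * q))) \<le> c * (n * (1 - exp (- (1 / n) * \<phi> q)))" for n :: nat
    proof -
      have cq: "0 < c * q" and h: "0 \<le> 1 / real n" using q c by auto
      have int: "integrable M (\<lambda>\<omega>. exp (- q * S (1 / n) \<omega>))" "integrable M (\<lambda>\<omega>. exp (- (c * q) * S (1 / n) \<omega>))"
        using q cq h by (intro integrable_exp_uminus random_variable_at AE_nonneg; simp)+
      have "expectation (\<lambda>\<omega>. 1 - exp (- (c * q) * S (1 / n) \<omega>)) \<le>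
          expectation (\<lambda>\<omega>. c * (1 - exp (- q * S (1 / n) \<omega>)))"
      proof (rule integral_mono_AE)
        show "AE \<omega> in M. 1 - exp (- (c * q) * S (1 / n) \<omega>) \<le> c * (1 - exp (- q * S (1 / n) \<omega>))"
          using AE_nonneg[OF h]
        proof eventually_elim
          case (elim \<omega>)
          then show ?case
            using one_minus_exp_scale[OF c, of "q * S (1 / n) \<omega>"] q by (simp add: mult.assoc)
        qed
      qed (use int in auto)
      then have "1 - exp (- (1 / n) * \<phi> (c * q)) \<le> c * (1 - exp (- (1 / n) * \<phi> q))"
        using int expectation_exp[OF q h] expectation_exp[OF cq h] by (simp add: prob_space)
      from mult_left_mono[OF this, of n] show ?thesis by (simp add: algebra_simps)
    qed
    then show "\<exists>N. \<forall>n::nat\<ge>N. n * (1 - exp (- (1 / n) * \<phi> (c * q))) \<le> c * (n * (1 - exp (- (1 / n) * \<phi> q)))"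
      by blast
  qed
  then show ?thesis by simp
qed

text \<open>As for \<open>exponent_scale\<close>, with H(q) recovered as the limit of n E g(q
  S_{1/n}) for g = \<open>exp_remainder\<close>.\<close>

lemma H_scale:
  assumes q: "0 < q" and c: "1 \<le> c"
  shows "H_of \<phi> (c * q) \<le> c\<^sup>2 * H_of \<phi> q"
proof -
  have cq: "0 < c * q" using q c by simp
  have "1 * H_of \<phi> (c * q) \<le> c\<^sup>2 * (1 * H_of \<phi> q)"
  proof (rule LIMSEQ_le)
    show "(\<lambda>n. n * expectation (\<lambda>\<omega>. exp_remainder (c * q * S (1 / n) \<omega>))) \<longlonglongrightarrow> 1 * H_of \<phi> (c * q)"
      by (rule LIMSEQ_exp_remainder) (use cq in auto)
    show "(\<lambda>n. c\<^sup>2 * (n * expectation (\<lambda>\<omega>. exp_remainder (q * S (1 / n) \<omega>)))) \<longlonglongrightarrow> c\<^sup>2 * (1 * H_of \<phi> q)"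
      by (intro tendsto_mult_left LIMSEQ_exp_remainder) (use q in auto)
    have "n * expectation (\<lambda>\<omega>. exp_remainder (c * q * S (1 / n) \<omega>)) \<le>
        c\<^sup>2 * (n * expectation (\<lambda>\<omega>. exp_remainder (q * S (1 / n) \<omega>)))" for n :: nat
    proof -
      have h: "0 \<le> 1 / real n" by simp
      have "expectation (\<lambda>\<omega>. exp_remainder (c * q * S (1 / n) \<omega>)) \<le>
          expectation (\<lambda>\<omega>. c\<^sup>2 * exp_remainder (q * S (1 / n) \<omega>))"
      proof (rule integral_mono_AE)
        show "AE \<omega> in M. exp_remainder (c * q * S (1 / n) \<omega>) \<le> c\<^sup>2 * exp_remainder (q * S (1 / n) \<omega>)"
          using AE_nonneg[OF h]
        proof eventually_elim
          case (elim \<omega>)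
          then show ?case
            using exp_remainder_scale[OF c, of "q * S (1 / n) \<omega>"] q by (simp add: mult.assoc)
        qed
      qed (use integrable_exp_remainder[OF q h] integrable_exp_remainder[OF cq h] in auto)
      from mult_left_mono[OF this, of n] show ?thesis by (simp add: algebra_simps)
    qed
    then show "\<exists>N. \<forall>n::nat\<ge>N. n * expectation (\<lambda>\<omega>. exp_remainder (c * q * S (1 / n) \<omega>)) \<le>
        c\<^sup>2 * (n * expectation (\<lambda>\<omega>. exp_remainder (q * S (1 / n) \<omega>)))"
      by blast
  qed
  then show ?thesis by simp
qed

text \<open>The event does not depend on n, so a bound for each n >= 1 passes to the limit. The
  constant 4e is the 2 of \<open>prob_ge_discretised\<close> times the 2e of
  \<open>min_one_sq_le_exp_remainder\<close>.\<close>

lemma prob_ge_le_H: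
  assumes q: "0 < q" and t: "0 \<le> t"
  shows "prob {\<omega> \<in> space M. 1 + exp 1 * t * \<phi> q \<le> q * S t \<omega>} \<le> 4 * exp 1 * (t * H_of \<phi> q)"
proof (rule LIMSEQ_le_const)
  show "(\<lambda>n. 4 * exp 1 * (n * expectation (\<lambda>\<omega>. exp_remainder (q * S (t / n) \<omega>)))) \<longlonglongrightarrow> 4 * exp 1 * (t * H_of \<phi> q)"
    by (intro tendsto_mult_left LIMSEQ_exp_remainder q t)
  have "prob {\<omega> \<in> space M. 1 + exp 1 * t * \<phi> q \<le> q * S t \<omega>} \<le>
      4 * exp 1 * (n * expectation (\<lambda>\<omega>. exp_remainder (q * S (t / n) \<omega>)))" if n: "1 \<le> n" for n :: nat
  proof -
    have h: "0 \<le> t / n" using t by simp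
    have [measurable]: "random_variable borel (S t)" "random_variable borel (S (t / n))"
      using t h by (auto intro: random_variable_at)
    have nonneg: "AE \<omega> in M. 0 \<le> q * S (t / n) \<omega>"
      using AE_nonneg[OF h] q by auto
    have int: "integrable M (\<lambda>\<omega>. exp (- q * S (t / n) \<omega>))"
      using q h by (intro integrable_exp_uminus AE_nonneg) auto
    have mint: "integrable M (\<lambda>\<omega>. min 1 (q * S (t / n) \<omega>))"
      by (rule integrable_const_bound[where B = 1]) (use nonneg in auto)
    have msint: "integrable M (\<lambda>\<omega>. (min 1 (q * S (t / n) \<omega>))\<^sup>2)"
      by (rule integrable_const_bound[where B = 1]) (use nonneg in \<open>auto simp: power_le_one\<close>)
    have "expectation (\<lambda>\<omega>. min 1 (q * S (t / n) \<omega>)) \<le> expectation (\<lambda>\<omega>. 2 * (1 - exp (- q * S (t / n) \<omega>)))"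
    proof (rule integral_mono_AE)
      show "AE \<omega> in M. min 1 (q * S (t / n) \<omega>) \<le> 2 * (1 - exp (- q * S (t / n) \<omega>))"
        using nonneg by eventually_elim (use min_one_le_exp in auto)
    qed (use int mint in auto)
    also have "\<dots> = 2 * (1 - exp (- (t / n) * \<phi> q))"
      using int expectation_exp[OF q h] by (simp add: prob_space)
    also have "\<dots> \<le> 2 * (t / n * \<phi> q)"
      using exp_ge_add_one_self[of "- (t / n) * \<phi> q"] by (simp del: exp_ge_add_one_self)
    finally have "n * expectation (\<lambda>\<omega>. min 1 (q * S (t / n) \<omega>)) \<le> n * (2 * (t / n * \<phi> q))"
      by (intro mult_left_mono) auto
    also have "\<dots> = 2 * (t * \<phi> q)"
      using n by simp
    \<comment> \<open>Here 2 = 1 + 1 <= e, and \<open>\<phi> q\<close> >= 0 is needed to enlarge the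
      factor.\<close>
    also have "\<dots> \<le> exp 1 * (t * \<phi> q)"
      using exponent_nonneg[OF q] t exp_ge_add_one_self[of 1] by (intro mult_right_mono) auto
    finally have mean: "n * expectation (\<lambda>\<omega>. min 1 (q * S (t / n) \<omega>)) \<le> exp 1 * t * \<phi> q"
      by (simp add: mult.assoc)
    \<comment> \<open>The threshold with e t phi(q) is at least the one with the truncated mean, so
      its event is smaller.\<close>
    have "prob {\<omega> \<in> space M. 1 + exp 1 * t * \<phi> q \<le> q * S t \<omega>} \<le>
        prob {\<omega> \<in> space M. 1 + n * expectation (\<lambda>\<omega>. min 1 (q * S (t / n) \<omega>)) \<le> q * S t \<omega>}"
      by (rule finite_measure_mono) (use mean in auto)
    also have "\<dots> \<le> 2 * (n * expectation (\<lambda>\<omega>. (min 1 (q * S (t / n) \<omega>))\<^sup>2))"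
      by (rule prob_ge_discretised) (use q t n in auto)
    also have "\<dots> \<le> 2 * (n * expectation (\<lambda>\<omega>. 2 * exp 1 * exp_remainder (q * S (t / n) \<omega>)))"
    proof -
      have "expectation (\<lambda>\<omega>. (min 1 (q * S (t / n) \<omega>))\<^sup>2) \<le> expectation (\<lambda>\<omega>. 2 * exp 1 * exp_remainder (q * S (t / n) \<omega>))"
      proof (rule integral_mono_AE)
        show "AE \<omega> in M. (min 1 (q * S (t / n) \<omega>))\<^sup>2 \<le> 2 * exp 1 * exp_remainder (q * S (t / n) \<omega>)"
          using nonneg by eventually_elim (rule min_one_sq_le_exp_remainder)
      qed (use msint integrable_exp_remainder[OF q h] in auto)
      then show ?thesis by (intro mult_left_mono) auto
    qed
    also have "\<dots> = 4 * exp 1 * (n * expectation (\<lambda>\<omega>. exp_remainder (q * S (t / n) \<omega>)))"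
      by simp
    finally show ?thesis .
  qed
  then show "\<exists>N. \<forall>n::nat\<ge>N. prob {\<omega> \<in> space M. 1 + exp 1 * t * \<phi> q \<le> q * S t \<omega>} \<le>
      4 * exp 1 * (n * expectation (\<lambda>\<omega>. exp_remainder (q * S (t / n) \<omega>)))"
    by blast
qed

section \<open>The two assertions at level r\<close>

lemma prob_ge_threshold_le_H:
  assumes r: "0 < r" and t: "0 < t"
  shows "prob {\<omega> \<in> space M. r * (1 + exp 1 * t * \<phi> (inverse r)) \<le> S t \<omega>} \<le>
           4 * exp 1 * t * H_of \<phi> (inverse r)"
proof -
  have "r * a \<le> x \<longleftrightarrow> a \<le> inverse r * x" for a x
    using r by (simp add: field_simps)
  then show ?thesis
    using prob_ge_le_H[of "inverse r" t] r t by (simp add: mult.assoc)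
qed

end

theorem proposition2p3:
  fixes M :: "'a measure" and S :: "real \<Rightarrow> 'a \<Rightarrow> real" and \<phi> :: "real \<Rightarrow> real"
  assumes "subordinator M S"
    and "is_laplace_exponent M S \<phi>"
  shows "\<exists>C>0.
    (\<forall>t>0. \<forall>r>0.
       \<P>(\<omega> in M. S t \<omega> \<ge> r * (1 + exp 1 * t * \<phi> (inverse r))) \<le> C * t * H_of \<phi> (inverse r)) \<and>
    (\<forall>\<epsilon> t r. 0 < \<epsilon> \<longrightarrow> \<epsilon> < 1 \<longrightarrow> t > 0 \<longrightarrow> r > 0 \<longrightarrow> t * \<phi> (inverse r) \<le> inverse (exp 1) * (1 - \<epsilon>) \<longrightarrow>
       \<P>(\<omega> in M. S t \<omega> \<ge> r) \<le> C * t * H_of \<phi> (inverse \<epsilon> * inverse r) \<and>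
       C * t * H_of \<phi> (inverse \<epsilon> * inverse r) \<le> C * inverse (\<epsilon>\<^sup>2) * t * H_of \<phi> (inverse r))"
proof -
  interpret subordinator_laplace M S \<phi>
    using assms by (simp add: subordinator_laplace_def subordinator_laplace_axioms_def)
  show ?thesis
  proof (intro exI[of _ "4 * exp 1"] conjI allI impI)
    show "prob {\<omega> \<in> space M. r * (1 + exp 1 * t * \<phi> (inverse r)) \<le> S t \<omega>} \<le>
           4 * exp 1 * t * H_of \<phi> (inverse r)" if "0 < t" "0 < r" for t r
      using prob_ge_threshold_le_H that by blast
  next
    fix \<epsilon> t r :: real
    assume \<epsilon>: "0 < \<epsilon>" "\<epsilon> < 1" and t: "0 < t" and r: "0 < r"
      and small: "t * \<phi> (inverse r) \<le> inverse (exp 1) * (1 - \<epsilon>)"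
    have c: "1 \<le> inverse \<epsilon>" and q: "0 < inverse r"
      using \<epsilon> r by (auto simp: field_simps)
    have [measurable]: "random_variable borel (S t)"
      using t by (intro random_variable_at) auto
    have small': "exp 1 * (t * \<phi> (inverse r)) \<le> 1 - \<epsilon>"
      using small by (simp add: field_simps)
    \<comment> \<open>Scaling by c = 1/epsilon gives epsilon phi(1/(epsilon r)) <= phi(1/r). With
      the smallness assumption, epsilon (1 + e t phi(1/(epsilon r))) is then at most epsilon + (1 -
      epsilon) = 1, so the threshold at level epsilon r does not exceed r.\<close>
    have "exp 1 * t * (\<epsilon> * \<phi> (inverse \<epsilon> * inverse r)) \<le> exp 1 * t * \<phi> (inverse r)"
      using exponent_scale[OF q c] \<epsilon> t by (intro mult_left_mono) (auto simp: field_simps)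
    then have "\<epsilon> * (1 + exp 1 * t * \<phi> (inverse (\<epsilon> * r))) \<le> 1"
      using small' by (simp add: algebra_simps)
    then have thr: "\<epsilon> * r * (1 + exp 1 * t * \<phi> (inverse (\<epsilon> * r))) \<le> r"
      using r mult_left_mono[of "\<epsilon> * (1 + exp 1 * t * \<phi> (inverse (\<epsilon> * r)))" 1 r]
      by (simp add: mult.assoc mult.left_commute[of r \<epsilon>] del: inverse_mult_distrib)
    have "prob {\<omega> \<in> space M. r \<le> S t \<omega>} \<le>
        prob {\<omega> \<in> space M. \<epsilon> * r * (1 + exp 1 * t * \<phi> (inverse (\<epsilon> * r))) \<le> S t \<omega>}"
      by (rule finite_measure_mono) (use thr in auto)
    also have "\<dots> \<le> 4 * exp 1 * t * H_of \<phi> (inverse (\<epsilon> * r))"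
      using prob_ge_threshold_le_H[of "\<epsilon> * r" t] \<epsilon> r t by simp
    finally show "prob {\<omega> \<in> space M. r \<le> S t \<omega>} \<le> 4 * exp 1 * t * H_of \<phi> (inverse \<epsilon> * inverse r)"
      by simp
    have "4 * exp 1 * t * H_of \<phi> (inverse \<epsilon> * inverse r) \<le>
        4 * exp 1 * t * ((inverse \<epsilon>)\<^sup>2 * H_of \<phi> (inverse r))"
      using H_scale[OF q c] t by (intro mult_left_mono) auto
    then show "4 * exp 1 * t * H_of \<phi> (inverse \<epsilon> * inverse r) \<le>
        4 * exp 1 * inverse (\<epsilon>\<^sup>2) * t * H_of \<phi> (inverse r)"
      by (simp add: power_inverse mult_ac)
  qed simp
qed

end
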